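(* Let $\mathcal{K}$ be a regular mean, let $I$ be an infinite set and let $a:I\to\mathbb{R}$ be a function such that $\{a(i):i\in I\}$ is infinite. Equip $I$ with the pseudo-metric $d(x,y)=|a(x)-a(y)|$, and let $s(K)=\mathcal{K}\big((a(i))_{i\in K}\big)$ for nonempty finite $K\subset I$. Then for every $c\in\mathbb{R}$: the unordered average of $a$ regarding $\mathcal{K}$ exists and equals $c$ if and only if $\mathrm{ext}(s,I)=c$.
   Context: A mean $\mathcal{K}$ of any number of variables assigns to every finite nonempty tuple of reals a real number with $\min_i a_i\le\mathcal{K}(a_1,\dots,a_n)\le\max_i a_i$. It is called regular if: (a) it is permutation invariant: $\mathcal{K}(a_1,\dots,a_n)=\mathcal{K}(a_{\sigma(1)},\dots,a_{\sigma(n)})$ for every permutation $\sigma$; (b) if $(a_n)$ is a real sequence with $a_n\to\alpha\in\overline{\mathbb{R}}=\mathbb{R}\cup\{-\infty,\infty\}$, then $\mathcal{K}(a_1,\dots,a_n)\to\alpha$; (c) if $J$ is an interval, $\mathcal{K}(a_1,\dots,a_n)\in J$ and $a_{n+1}\in J$, then $\mathcal{K}(a_1,\dots,a_{n+1})\in J$. For a finite nonempty $K\subset I$, $\mathcal{K}\big((a(i))_{i\in K}\big)$ denotes $\mathcal{K}$ applied to the family of values $a(i)$, $i\in K$ (one entry for each $i\in K$; the order is irrelevant by (a)). The unordered average of $a:I\to\mathbb{R}$ regarding $\mathcal{K}$ exists and equals $c\in\mathbb{R}$ if for every $\epsilon>0$ there is a finite set $I_0\subset I$ such that every finite $I_1$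 with $I_0\subset I_1\subset I$ satisfies $|\mathcal{K}((a(i))_{i\in I_1})-c|<\epsilon$. For a set $I$, $[I]^{<\infty}$ is the set of all finite subsets of $I$. For a pseudo-metric space $(I,d)$, $A\subset I$ and $\epsilon>0$, let $S(A,\epsilon)=\bigcup_{x\in A}\{y\in I: d(x,y)<\epsilon\}$. The Hausdorff pseudo-metric on subsets of $I$ is $d_H(A,C)=\inf\{\epsilon>0: A\subset S(C,\epsilon),\ C\subset S(A,\epsilon)\}$ (with $\inf\emptyset=+\infty$). $I$ is totally bounded if for every $\delta>0$ there is a finite $K\subset I$ with $S(K,\delta)=I$. The assertion $\mathrm{ext}(s,I)=A$ ($A\in\mathbb{R}$) means: $(I,d)$ is totally bounded and for every $\epsilon>0$ there is $\delta>0$ such that $K\in[I]^{<\infty}$ and $d_H(K,I)<\delta$ imply $|s(K)-A|<\epsilon$. (The value of $s$ at $\emptyset$ is immaterial since $d_H(\emptyset,I)=+\infty$.) *)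

theory Defs
  imports "HOL-Analysis.Analysis" "HOL-Combinatorics.Permutations" "HOL-Library.Multiset"
begin

text \<open>A mean of any number of variables is a function on lists of reals; its value on the empty
  list is arbitrary, so every condition below is restricted to nonempty lists.\<close>

definition is_mean :: "(real list \<Rightarrow> real) \<Rightarrow> bool" where
  "is_mean \<K> \<longleftrightarrow> (\<forall>xs. xs \<noteq> [] \<longrightarrow> Min (set xs) \<le> \<K> xs \<and> \<K> xs \<le> Max (set xs))"

definition permutation_invariant :: "(real list \<Rightarrow> real) \<Rightarrow> bool" where
  "permutation_invariant \<K> \<longleftrightarrow>
     (\<forall>xs \<sigma>. xs \<noteq> [] \<longrightarrow> \<sigma> permutes {..<length xs} \<longrightarrow> \<K> (permute_list \<sigma> xs) = \<K> xs)"

text \<open>The limit \<open>\<alpha>\<close> ranges over the extended reals. Sequences are indexed from \<open>0\<close>, hence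
  \<open>Suc n\<close>: the mean of the first \<open>n + 1\<close> terms.\<close>

definition limit_preserving :: "(real list \<Rightarrow> real) \<Rightarrow> bool" where
  "limit_preserving \<K> \<longleftrightarrow>
     (\<forall>(x :: nat \<Rightarrow> real) (\<alpha> :: ereal).
        (\<lambda>n. ereal (x n)) \<longlonglongrightarrow> \<alpha> \<longrightarrow>
        (\<lambda>n. ereal (\<K> (map x [0..<Suc n]))) \<longlonglongrightarrow> \<alpha>)"

definition interval_stable :: "(real list \<Rightarrow> real) \<Rightarrow> bool" where
  "interval_stable \<K> \<longleftrightarrow>
     (\<forall>(J :: real set) xs y.
        is_interval J \<longrightarrow> xs \<noteq> [] \<longrightarrow> \<K> xs \<in> J \<longrightarrow> y \<in> J \<longrightarrow> \<K> (xs @ [y]) \<in> J)"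

definition regular_mean :: "(real list \<Rightarrow> real) \<Rightarrow> bool" where
  "regular_mean \<K> \<longleftrightarrow>
     is_mean \<K> \<and> permutation_invariant \<K> \<and> limit_preserving \<K> \<and> interval_stable \<K>"

text \<open>\<open>\<K>\<close> applied to the family \<open>(a i)\<close>, \<open>i \<in> A\<close>, for finite \<open>A\<close>: the multiset image keeps one
  entry per index, so repeated values are counted with multiplicity. Increasing order is an
  arbitrary choice, irrelevant for a permutation invariant mean.\<close>

definition family_mean :: "(real list \<Rightarrow> real) \<Rightarrow> ('i \<Rightarrow> real) \<Rightarrow> 'i set \<Rightarrow> real" where
  "family_mean \<K> a A = \<K> (sorted_list_of_multiset (image_mset a (mset_set A)))"

text \<open>The condition \<open>I\<^sub>1 \<noteq> {}\<close> only says that means are taken of nonempty families.\<close>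

definition unordered_average_is ::
    "(real list \<Rightarrow> real) \<Rightarrow> 'i set \<Rightarrow> ('i \<Rightarrow> real) \<Rightarrow> real \<Rightarrow> bool" where
  "unordered_average_is \<K> I a c \<longleftrightarrow>
     (\<forall>\<epsilon>>0. \<exists>I\<^sub>0. finite I\<^sub>0 \<and> I\<^sub>0 \<subseteq> I \<and>
        (\<forall>I\<^sub>1. finite I\<^sub>1 \<and> I\<^sub>1 \<noteq> {} \<and> I\<^sub>0 \<subseteq> I\<^sub>1 \<and> I\<^sub>1 \<subseteq> I \<longrightarrow> \<bar>family_mean \<K> a I\<^sub>1 - c\<bar> < \<epsilon>))"

text \<open>Pseudo-metric spaces are given by a carrier set \<open>I\<close> and a distance function \<open>d\<close>; the library
  notions for metric spaces do not apply, as distinct points may have distance \<open>0\<close>.\<close>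

definition nbhd :: "'i set \<Rightarrow> ('i \<Rightarrow> 'i \<Rightarrow> real) \<Rightarrow> 'i set \<Rightarrow> real \<Rightarrow> 'i set" where
  "nbhd I d A \<epsilon> = (\<Union>x\<in>A. {y \<in> I. d x y < \<epsilon>})"

text \<open>In \<^typ>\<open>ereal\<close> the infimum of the empty set is \<open>\<infinity>\<close>.\<close>

definition hausdorff_dist :: "'i set \<Rightarrow> ('i \<Rightarrow> 'i \<Rightarrow> real) \<Rightarrow> 'i set \<Rightarrow> 'i set \<Rightarrow> ereal" where
  "hausdorff_dist I d A C =
     Inf {ereal \<epsilon> | \<epsilon>. \<epsilon> > 0 \<and> A \<subseteq> nbhd I d C \<epsilon> \<and> C \<subseteq> nbhd I d A \<epsilon>}"

definition pm_totally_bounded :: "'i set \<Rightarrow> ('i \<Rightarrow> 'i \<Rightarrow> real) \<Rightarrow> bool" where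
  "pm_totally_bounded I d \<longleftrightarrow> (\<forall>\<delta>>0. \<exists>K. finite K \<and> K \<subseteq> I \<and> nbhd I d K \<delta> = I)"

definition ext_is ::
    "('i set \<Rightarrow> real) \<Rightarrow> 'i set \<Rightarrow> ('i \<Rightarrow> 'i \<Rightarrow> real) \<Rightarrow> real \<Rightarrow> bool" where
  "ext_is s I d A \<longleftrightarrow>
     pm_totally_bounded I d \<and>
     (\<forall>\<epsilon>>0. \<exists>\<delta>>0. \<forall>K. finite K \<and> K \<subseteq> I \<and> hausdorff_dist I d K I < ereal \<delta> \<longrightarrow> \<bar>s K - A\<bar> < \<epsilon>)"

end

theory Submission imports Defs begin

text \<open>If the unordered average is \<open>c\<close>, then \<open>c\<close> is the only limit in the extended reals of
  \<open>a\<close> along injective sequences of indices: put a large finite set of indices in front of such a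
  sequence and use limit preservation. Hence only finitely many indices have values
  outside a given interval \<open>J\<close> around \<open>c\<close>, which gives total boundedness. Moreover, by limit
  preservation, there are finitely many values \<open>z\<^sub>0, \<dots>, z\<^sub>k\<close> of \<open>a\<close> in \<open>J - {c}\<close> that bring the mean
  of every set of outliers back into \<open>J\<close>, where it then stays, by interval stability, when further
  elements of \<open>J\<close> are added. The values \<open>z\<^sub>0, \<dots>, z\<^sub>k\<close> are isolated in \<open>a(I)\<close>, so every finite
  set of indices sufficiently close to \<open>I\<close> attains all of them.\<close>

section \<open>Regular means evaluated along lists\<close>

lemma permutation_invariant_mset_cong:
  assumes "permutation_invariant \<K>" "mset xs = mset ys"
  shows "\<K> xs = \<K> ys"
proof (cases "ys = []")
  case False
  obtain p where "p permutes {..<length ys}" "permute_list p ys = xs"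
    using mset_eq_permutation[OF assms(2)] by blast
  then show ?thesis
    using assms(1) False unfolding permutation_invariant_def by blast
qed (use assms in simp)

text \<open>Permutation invariance makes the sorted order in \<open>family_mean\<close> irrelevant,
  so indices can be listed in whatever order suits an argument.\<close>

lemma family_mean_set:
  assumes "permutation_invariant \<K>" "distinct js"
  shows "family_mean \<K> a (set js) = \<K> (map a js)"
  unfolding family_mean_def
  using assms by (intro permutation_invariant_mset_cong) (simp_all add: mset_set_set)

lemma interval_stable_append:
  assumes "interval_stable \<K>" "is_interval J" "xs \<noteq> []" "\<K> xs \<in> J" "set ys \<subseteq> J"
  shows "\<K> (xs @ ys) \<in> J"
  using assms(5)
proof (induction ys rule: rev_induct)
  case (snoc y ys)
  then have "\<K> ((xs @ ys) @ [y]) \<in> J"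
    using assms(1-3) unfolding interval_stable_def by (metis append_is_Nil_conv
      insert_subset le_sup_iff list.simps(15) set_append)
  then show ?case by simp
qed (use assms in simp)

text \<open>Prepending \<open>ys\<close> keeps the limit of \<open>z\<close>, and the initial
  segments of the new sequence that contain \<open>ys\<close> are the lists in the claim.\<close>

lemma limit_preserving_prefix:
  assumes "limit_preserving \<K>" "(\<lambda>n. ereal (z n)) \<longlonglongrightarrow> \<alpha>"
  shows "(\<lambda>k. ereal (\<K> (ys @ map z [0..<k]))) \<longlonglongrightarrow> \<alpha>"
proof -
  define x where "x n = (if n < length ys then ys ! n else z (n - length ys))" for n
  have "(\<lambda>n. ereal (x (n + length ys))) \<longlonglongrightarrow> \<alpha>"
    using assms(2) by (simp add: x_def)
  then have "(\<lambda>n. ereal (x n)) \<longlonglongrightarrow> \<alpha>"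
    by (rule LIMSEQ_offset)
  then have "(\<lambda>n. ereal (\<K> (map x [0..<Suc n]))) \<longlonglongrightarrow> \<alpha>"
    using assms(1) unfolding limit_preserving_def by blast
  \<comment> \<open>Passing from \<open>Suc n\<close> to \<open>n\<close> only adds the mean of the
    empty list, which cannot affect the limit.\<close>
  then have "(\<lambda>n. ereal (\<K> (map x [0..<n]))) \<longlonglongrightarrow> \<alpha>"
    by (rule LIMSEQ_imp_Suc)
  then have "(\<lambda>k. ereal (\<K> (map x [0..<k + length ys]))) \<longlonglongrightarrow> \<alpha>"
    by (rule LIMSEQ_ignore_initial_segment)
  moreover have "map x [0..<k + length ys] = ys @ map z [0..<k]" for k
    by (rule nth_equalityI) (auto simp: x_def nth_append)
  ultimately show ?thesis by simp
qed

section \<open>Finiteness of the set of outliers\<close>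

lemma unordered_average_limit_unique:
  assumes reg: "regular_mean \<K>" and avg: "unordered_average_is \<K> I a c"
    and f: "inj f" "range f \<subseteq> I" and lim: "(\<lambda>n. ereal (a (f n))) \<longlonglongrightarrow> \<alpha>"
  shows "\<alpha> = ereal c"
proof -
  have bounds: "ereal (c - \<epsilon>) \<le> \<alpha> \<and> \<alpha> \<le> ereal (c + \<epsilon>)" if "\<epsilon> > 0" for \<epsilon>
  proof -
    obtain I\<^sub>0 where I0: "finite I\<^sub>0" "I\<^sub>0 \<subseteq> I"
      and close: "\<And>I\<^sub>1. finite I\<^sub>1 \<Longrightarrow> I\<^sub>1 \<noteq> {} \<Longrightarrow> I\<^sub>0 \<subseteq> I\<^sub>1 \<Longrightarrow> I\<^sub>1 \<subseteq> I \<Longrightarrow>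
        \<bar>family_mean \<K> a I\<^sub>1 - c\<bar> < \<epsilon>"
      using avg \<open>\<epsilon> > 0\<close> unfolding unordered_average_is_def by metis
    obtain js where js: "set js = I\<^sub>0" "distinct js"
      using finite_distinct_list[OF I0(1)] by blast
    \<comment> \<open>By injectivity \<open>f\<close> visits \<open>I\<^sub>0\<close> only finitely
      often. Its tail \<open>g\<close> avoids \<open>I\<^sub>0\<close>, so \<open>js\<close>
      followed by terms of \<open>g\<close> repeats no index.\<close>
    have "finite (f -` I\<^sub>0)"
      using I0(1) f(1) by (rule finite_vimageI)
    then obtain N where N: "\<And>n. n \<in> f -` I\<^sub>0 \<Longrightarrow> n < N"
      by (metis finite_nat_bounded lessThan_iff subsetD)
    define g where "g n = f (n + N)" for n
    have g: "g n \<in> I - I\<^sub>0" for n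
      using N[of "n + N"] f(2) by (auto simp: g_def)
    have inj_g: "inj g"
      by (rule injI) (use f(1) in \<open>auto simp: g_def dest: injD\<close>)
    have "(\<lambda>n. ereal (a (g n))) \<longlonglongrightarrow> \<alpha>"
      unfolding g_def using lim by (rule LIMSEQ_ignore_initial_segment)
    then have lim_g: "(\<lambda>k. ereal (\<K> (map a js @ map (\<lambda>n. a (g n)) [0..<k]))) \<longlonglongrightarrow> \<alpha>"
      using reg by (intro limit_preserving_prefix) (simp_all add: regular_mean_def)
    have near: "\<bar>\<K> (map a js @ map (\<lambda>n. a (g n)) [0..<k]) - c\<bar> < \<epsilon>" if "k \<ge> 1" for k
    proof -
      let ?l = "js @ map g [0..<k]"
      have "distinct ?l"
        using js g inj_g by (auto simp: distinct_map inj_on_def)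
      moreover have "set ?l \<noteq> {}" "I\<^sub>0 \<subseteq> set ?l" "set ?l \<subseteq> I"
        using js I0 g that by auto
      ultimately show ?thesis
        using close[of "set ?l"] reg family_mean_set[of \<K> ?l a]
        by (simp add: regular_mean_def o_def del: set_append set_map)
    qed
    have "\<exists>M. \<forall>k\<ge>M. ereal (c - \<epsilon>) \<le> ereal (\<K> (map a js @ map (\<lambda>n. a (g n)) [0..<k]))"
      "\<exists>M. \<forall>k\<ge>M. ereal (\<K> (map a js @ map (\<lambda>n. a (g n)) [0..<k])) \<le> ereal (c + \<epsilon>)"
      using near by (force simp: abs_less_iff)+
    then show ?thesis
      using LIMSEQ_le_const[OF lim_g] LIMSEQ_le_const2[OF lim_g] by blast
  qed
  then show ?thesis
  proof (cases \<alpha>)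
    case (real r)
    have "\<bar>r - c\<bar> \<le> \<epsilon>" if "\<epsilon> > 0" for \<epsilon>
      using bounds[OF that] real by auto
    then show ?thesis
      using real zero_less_abs_iff[of "r - c"] field_le_epsilon[of "\<bar>r - c\<bar>" 0] by auto
  qed (use bounds[of 1] in auto)
qed

text \<open>Infinitely many outliers would supply an injective sequence whose values, by compactness
  of the extended reals, have a limit point. It must be \<open>c\<close>, yet all terms stay at
  least \<open>\<epsilon>\<close> away from \<open>c\<close>.\<close>

lemma unordered_average_finite_outliers:
  assumes reg: "regular_mean \<K>" and avg: "unordered_average_is \<K> I a c" and "\<epsilon> > 0"
  shows "finite {i \<in> I. \<bar>a i - c\<bar> \<ge> \<epsilon>}"
proof (rule ccontr)
  assume "infinite {i \<in> I. \<bar>a i - c\<bar> \<ge> \<epsilon>}"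
  then obtain f :: "nat \<Rightarrow> 'a" where f: "inj f" "range f \<subseteq> {i \<in> I. \<bar>a i - c\<bar> \<ge> \<epsilon>}"
    using infinite_countable_subset by blast
  obtain \<alpha> r where r: "strict_mono r" "((\<lambda>n. ereal (a (f n))) \<circ> r) \<longlonglongrightarrow> \<alpha>"
    using compact_complete_linorder by blast
  then have lim: "(\<lambda>n. ereal (a ((f \<circ> r) n))) \<longlonglongrightarrow> \<alpha>"
    by (simp add: o_def)
  moreover have "inj (f \<circ> r)" "range (f \<circ> r) \<subseteq> I"
    using f r(1) by (auto intro: inj_compose strict_mono_imp_inj_on)
  ultimately have "\<alpha> = ereal c"
    using unordered_average_limit_unique[OF reg avg] by blast
  then have "(\<lambda>n. a (f (r n))) \<longlonglongrightarrow> c"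
    using lim by simp
  then obtain n where "\<bar>a (f (r n)) - c\<bar> < \<epsilon>"
    using \<open>\<epsilon> > 0\<close> by (auto simp: LIMSEQ_def dist_real_def)
  then show False
    using f(2) by (auto simp: image_subset_iff not_le[symmetric])
qed

text \<open>Values near \<open>v\<close> are bounded away from \<open>c\<close>, so only finitely
  many indices carry them; among those different from \<open>v\<close> there is a least distance to
  \<open>v\<close>.\<close>

lemma isolated_value:
  fixes a :: "'i \<Rightarrow> real"
  assumes fin: "\<And>\<epsilon>. \<epsilon> > 0 \<Longrightarrow> finite {i \<in> I. \<bar>a i - c\<bar> \<ge> \<epsilon>}" and "v \<noteq> c"
  shows "\<exists>\<delta>>0. \<forall>i\<in>I. \<bar>a i - v\<bar> < \<delta> \<longrightarrow> a i = v"
proof -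
  define \<eta> where "\<eta> = \<bar>v - c\<bar> / 2"
  have "\<eta> > 0"
    using \<open>v \<noteq> c\<close> by (simp add: \<eta>_def)
  \<comment> \<open>Including \<open>\<eta>\<close> keeps the set nonempty and forces every index
    with value closer to \<open>v\<close> than \<open>Min ?D\<close> to be an outlier at level
    \<open>\<eta>\<close>.\<close>
  let ?D = "insert \<eta> ((\<lambda>i. \<bar>a i - v\<bar>) ` {i \<in> I. \<bar>a i - c\<bar> \<ge> \<eta> \<and> a i \<noteq> v})"
  have "finite ?D"
    by (intro finite.insertI finite_imageI finite_subset[OF _ fin[OF \<open>\<eta> > 0\<close>]]) auto
  moreover have "d > 0" if "d \<in> ?D" for d
    using that \<open>\<eta> > 0\<close> by auto
  ultimately have "Min ?D > 0"
    by (subst Min_gr_iff) auto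
  moreover have "a i = v" if "i \<in> I" "\<bar>a i - v\<bar> < Min ?D" for i
  proof (rule ccontr)
    assume "a i \<noteq> v"
    have "\<bar>a i - v\<bar> < \<eta>"
      using that(2) \<open>finite ?D\<close> by (meson Min_le insertI1 less_le_trans)
    moreover have "2 * \<eta> \<le> \<bar>a i - v\<bar> + \<bar>a i - c\<bar>"
      unfolding \<eta>_def by simp
    ultimately have "\<bar>a i - c\<bar> \<ge> \<eta>"
      by linarith
    then have "\<bar>a i - v\<bar> \<in> ?D"
      using that(1) \<open>a i \<noteq> v\<close> by blast
    then have "Min ?D \<le> \<bar>a i - v\<bar>"
      by (rule Min_le[OF \<open>finite ?D\<close>])
    then show False
      using that(2) by linarith
  qed
  ultimately show ?thesis by blast
qed

section \<open>From the extension to the unordered average\<close>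

text \<open>A finite net serves as \<open>I\<^sub>0\<close>: every larger finite set is again a net,
  hence Hausdorff-close to \<open>I\<close>.\<close>

lemma ext_is_imp_unordered_average_is:
  assumes d: "\<And>x. x \<in> I \<Longrightarrow> d x x = 0"
    and ext: "ext_is (family_mean \<K> a) I d c"
  shows "unordered_average_is \<K> I a c"
  unfolding unordered_average_is_def
proof (intro allI impI)
  fix \<epsilon> :: real assume "\<epsilon> > 0"
  then obtain \<delta> where \<delta>: "\<delta> > 0" and close: "\<And>K. finite K \<Longrightarrow> K \<subseteq> I \<Longrightarrow>
      hausdorff_dist I d K I < ereal \<delta> \<Longrightarrow> \<bar>family_mean \<K> a K - c\<bar> < \<epsilon>"
    using ext unfolding ext_is_def by metis
  \<comment> \<open>The radius is halved since it bounds the Hausdorff distance only weakly, while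
    \<open>close\<close> needs a strict inequality.\<close>
  obtain K where K: "finite K" "K \<subseteq> I" "nbhd I d K (\<delta> / 2) = I"
    using ext \<delta> unfolding ext_is_def pm_totally_bounded_def by (meson half_gt_zero)
  have "\<bar>family_mean \<K> a I\<^sub>1 - c\<bar> < \<epsilon>" if "finite I\<^sub>1" "K \<subseteq> I\<^sub>1" "I\<^sub>1 \<subseteq> I" for I\<^sub>1
  proof (rule close)
    have "I \<subseteq> nbhd I d I\<^sub>1 (\<delta> / 2)"
      using K(3) that(2) unfolding nbhd_def by blast
    moreover have "I\<^sub>1 \<subseteq> nbhd I d I (\<delta> / 2)"
      using that(3) \<delta> d unfolding nbhd_def by fastforce
    ultimately have "hausdorff_dist I d I\<^sub>1 I \<le> ereal (\<delta> / 2)"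
      unfolding hausdorff_dist_def using \<delta> by (intro Inf_lower CollectI exI[of _ "\<delta> / 2"]) auto
    also have "\<dots> < ereal \<delta>"
      using \<delta> by simp
    finally show "hausdorff_dist I d I\<^sub>1 I < ereal \<delta>" .
  qed (use that in auto)
  then show "\<exists>I\<^sub>0. finite I\<^sub>0 \<and> I\<^sub>0 \<subseteq> I \<and> (\<forall>I\<^sub>1. finite I\<^sub>1 \<and> I\<^sub>1 \<noteq> {} \<and> I\<^sub>0 \<subseteq> I\<^sub>1 \<and> I\<^sub>1 \<subseteq> I \<longrightarrow>
      \<bar>family_mean \<K> a I\<^sub>1 - c\<bar> < \<epsilon>)"
    using K by blast
qed

section \<open>From finitely many outliers to the extension\<close>

text \<open>The outliers at level \<open>\<delta> / 2\<close> and one further index form a net, as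
  any two values within \<open>\<delta> / 2\<close> of \<open>c\<close> differ by less than
  \<open>\<delta>\<close>.\<close>

lemma finite_outliers_imp_totally_bounded:
  assumes fin: "\<And>\<epsilon>. \<epsilon> > 0 \<Longrightarrow> finite {i \<in> I. \<bar>a i - c\<bar> \<ge> \<epsilon>}" and "infinite I"
  shows "pm_totally_bounded I (\<lambda>x y. \<bar>a x - a y\<bar>)"
  unfolding pm_totally_bounded_def
proof (intro allI impI)
  fix \<delta> :: real assume "\<delta> > 0"
  let ?F = "{i \<in> I. \<bar>a i - c\<bar> \<ge> \<delta> / 2}"
  have F: "finite ?F"
    using \<open>\<delta> > 0\<close> by (intro fin) simp
  then obtain i where i: "i \<in> I" "\<bar>a i - c\<bar> < \<delta> / 2"
    using \<open>infinite I\<close> by (metis (mono_tags, lifting) finite_subset mem_Collect_eq not_le subsetI)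
  have "x \<in> nbhd I (\<lambda>x y. \<bar>a x - a y\<bar>) (insert i ?F) \<delta>" if "x \<in> I" for x
  proof (cases "x \<in> ?F")
    case True
    then show ?thesis
      using that \<open>\<delta> > 0\<close> unfolding nbhd_def by force
  next
    case False
    then have "\<bar>a x - c\<bar> < \<delta> / 2"
      using that by simp
    then have "\<bar>a i - a x\<bar> < \<delta>"
      using i(2) by linarith
    then show ?thesis
      using that unfolding nbhd_def by blast
  qed
  then have "nbhd I (\<lambda>x y. \<bar>a x - a y\<bar>) (insert i ?F) \<delta> = I"
    by (auto simp: nbhd_def)
  then show "\<exists>K. finite K \<and> K \<subseteq> I \<and> nbhd I (\<lambda>x y. \<bar>a x - a y\<bar>) K \<delta> = I"
    using F i(1) by (intro exI[of _ "insert i ?F"]) auto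
qed

text \<open>An injective sequence takes each of the finitely many outlying values at most
  once.\<close>

lemma distinct_values_tendsto:
  fixes a :: "'i \<Rightarrow> real"
  assumes fin: "\<And>\<epsilon>. \<epsilon> > 0 \<Longrightarrow> finite {i \<in> I. \<bar>a i - c\<bar> \<ge> \<epsilon>}"
    and z: "inj z" "range z \<subseteq> a ` I"
  shows "z \<longlonglongrightarrow> c"
proof (rule LIMSEQ_I)
  fix \<epsilon> :: real assume "\<epsilon> > 0"
  have "finite (z -` (a ` {i \<in> I. \<bar>a i - c\<bar> \<ge> \<epsilon>}))"
    using fin[OF \<open>\<epsilon> > 0\<close>] z(1) by (intro finite_vimageI) auto
  then obtain N where N: "z -` (a ` {i \<in> I. \<bar>a i - c\<bar> \<ge> \<epsilon>}) \<subseteq> {..<N}"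
    using finite_nat_bounded by blast
  have "norm (z n - c) < \<epsilon>" if "n \<ge> N" for n
  proof (rule ccontr)
    assume far: "\<not> norm (z n - c) < \<epsilon>"
    obtain i where "i \<in> I" "z n = a i"
      using z(2) by blast
    then have "n \<in> z -` (a ` {i \<in> I. \<bar>a i - c\<bar> \<ge> \<epsilon>})"
      using far by auto
    then have "n < N"
      using N by blast
    then show False
      using that by simp
  qed
  then show "\<exists>N. \<forall>n\<ge>N. norm (z n - c) < \<epsilon>" by blast
qed

text \<open>The tolerance has to be chosen before \<open>K\<close>. This is possible because the
  outliers in \<open>K\<close> form one of finitely many subsets of \<open>F\<close>, so a single
  \<open>k\<close> suits them all.\<close>

lemma family_mean_near_if_hausdorff_near:
  fixes a :: "'i \<Rightarrow> real"
  assumes reg: "regular_mean \<K>"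
    and fin: "\<And>\<epsilon>. \<epsilon> > 0 \<Longrightarrow> finite {i \<in> I. \<bar>a i - c\<bar> \<ge> \<epsilon>}"
    and "infinite (a ` I)" and "\<epsilon> > 0"
  shows "\<exists>\<delta>>0. \<forall>K. finite K \<and> K \<subseteq> I \<and>
    hausdorff_dist I (\<lambda>x y. \<bar>a x - a y\<bar>) K I < ereal \<delta> \<longrightarrow> \<bar>family_mean \<K> a K - c\<bar> < \<epsilon>"
proof -
  define F where "F = {i \<in> I. \<bar>a i - c\<bar> \<ge> \<epsilon>}"
  have F: "finite F"
    using fin \<open>\<epsilon> > 0\<close> by (simp add: F_def)
  \<comment> \<open>Omitting \<open>c\<close> makes every \<open>z n\<close> isolated; omitting the
    values on \<open>F\<close> keeps the indices that attain \<open>z n\<close> apart from the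
    outliers.\<close>
  have "infinite (a ` I - insert c (a ` F))"
    using F \<open>infinite (a ` I)\<close> by (simp add: Diff_infinite_finite)
  then obtain z :: "nat \<Rightarrow> real" where z: "inj z" "range z \<subseteq> a ` I - insert c (a ` F)"
    using infinite_countable_subset by blast
  have "z \<longlonglongrightarrow> c"
    using z by (intro distinct_values_tendsto[OF fin]) auto
  have zF: "z n \<notin> a ` F" for n
    using z(2) by blast
  \<comment> \<open>One enumeration \<open>l M\<close> is fixed per finite set, so that the
    threshold for \<open>k\<close> depends on \<open>M\<close> alone.\<close>
  have "\<forall>M :: 'i set. \<exists>js. finite M \<longrightarrow> set js = M \<and> distinct js"
    using finite_distinct_list by blast
  then obtain l where l: "\<And>M :: 'i set. finite M \<Longrightarrow> set (l M) = M \<and> distinct (l M)"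
    by metis
  have "\<forall>\<^sub>F k in sequentially. \<bar>\<K> (map a (l M) @ map z [0..<k]) - c\<bar> < \<epsilon>" for M
  proof -
    have "(\<lambda>k. ereal (\<K> (map a (l M) @ map z [0..<k]))) \<longlonglongrightarrow> ereal c"
      using reg \<open>z \<longlonglongrightarrow> c\<close> by (intro limit_preserving_prefix) (simp_all add: regular_mean_def)
    then have "(\<lambda>k. \<K> (map a (l M) @ map z [0..<k])) \<longlonglongrightarrow> c"
      by simp
    then show ?thesis
      using \<open>\<epsilon> > 0\<close> by (auto simp: tendsto_iff dist_real_def)
  qed
  then have "\<forall>\<^sub>F k in sequentially. \<forall>M\<in>Pow F. \<bar>\<K> (map a (l M) @ map z [0..<k]) - c\<bar> < \<epsilon>"
    using F by (intro eventually_ball_finite) auto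
  \<comment> \<open>\<open>k > 0\<close> keeps the list nonempty when \<open>M\<close> is empty, and
    likewise the set whose minimum defines \<open>\<delta>\<close>.\<close>
  from eventually_conj[OF eventually_gt_at_top[of 0] this] obtain k where k: "k > 0"
    and near: "\<And>M. M \<subseteq> F \<Longrightarrow> \<bar>\<K> (map a (l M) @ map z [0..<k]) - c\<bar> < \<epsilon>"
    by (auto dest: eventually_happens)
  have "\<forall>n. \<exists>\<delta>>0. \<forall>i\<in>I. \<bar>a i - z n\<bar> < \<delta> \<longrightarrow> a i = z n"
    using z(2) by (intro allI isolated_value[OF fin]) auto
  then obtain \<Delta> where \<Delta>: "\<And>n. \<Delta> n > 0" "\<And>n i. i \<in> I \<Longrightarrow> \<bar>a i - z n\<bar> < \<Delta> n \<Longrightarrow> a i = z n"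
    by metis
  define \<delta> where "\<delta> = Min (\<Delta> ` {..<k})"
  have "\<delta> > 0"
    unfolding \<delta>_def using k \<Delta>(1) by (subst Min_gr_iff) auto
  have \<delta>_le: "\<delta> \<le> \<Delta> n" if "n < k" for n
    unfolding \<delta>_def using that by (intro Min_le) auto
  have "\<bar>family_mean \<K> a K - c\<bar> < \<epsilon>"
    if K: "finite K" "K \<subseteq> I" and dist: "hausdorff_dist I (\<lambda>x y. \<bar>a x - a y\<bar>) K I < ereal \<delta>" for K
  proof -
    obtain e where "e < \<delta>" and cover: "I \<subseteq> nbhd I (\<lambda>x y. \<bar>a x - a y\<bar>) K e"
      using dist unfolding hausdorff_dist_def Inf_less_iff by auto
    \<comment> \<open>Some index in \<open>K\<close> has value closer than \<open>\<delta>\<close>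
      to \<open>z n\<close>; isolation forces equality.\<close>
    have "\<exists>j\<in>K. a j = z n" if "n < k" for n
    proof -
      obtain i where i: "i \<in> I" "z n = a i"
        using z(2) by blast
      then obtain j where j: "j \<in> K" "\<bar>a j - a i\<bar> < e"
        using cover unfolding nbhd_def by blast
      then have "a j = z n"
        using \<Delta>(2)[of j n] i K(2) \<open>e < \<delta>\<close> \<delta>_le[OF that] by auto
      then show ?thesis
        using j(1) by blast
    qed
    then obtain j where j: "\<And>n. n < k \<Longrightarrow> j n \<in> K \<and> a (j n) = z n"
      by metis
    \<comment> \<open>\<open>K\<close> is listed with outliers first, then indices attaining the
      \<open>z n\<close>, then the rest, whose values lie in the interval.\<close>
    let ?M = "l (K \<inter> F)" and ?R = "l (K - F - j ` {..<k})"
    have M: "set ?M = K \<inter> F" "distinct ?M" and R: "set ?R = K - F - j ` {..<k}" "distinct ?R"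
      using l K(1) by auto
    have jF: "j n \<notin> F" if "n < k" for n
      using zF j[OF that] by (metis imageI)
    have js: "map a (map j [0..<k]) = map z [0..<k]"
      using j by simp
    \<comment> \<open>Distinct values come from distinct indices, so \<open>j\<close> repeats none
      below \<open>k\<close>.\<close>
    have "distinct (map z [0..<k])"
      using z(1) by (simp add: distinct_map inj_on_def inj_def)
    then have "distinct (map j [0..<k])"
      unfolding js[symmetric] by (metis distinct_map)
    then have "distinct (?M @ map j [0..<k] @ ?R)"
      using M R jF by auto
    moreover have "set (?M @ map j [0..<k] @ ?R) = K"
      using M R j by auto
    ultimately have "family_mean \<K> a K = \<K> (map a (?M @ map j [0..<k] @ ?R))"
      using family_mean_set reg unfolding regular_mean_def by metis
    also have "\<dots> = \<K> ((map a ?M @ map z [0..<k]) @ map a ?R)"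
      unfolding map_append js by simp
    also have "\<dots> \<in> {c - \<epsilon><..<c + \<epsilon>}"
    proof (rule interval_stable_append)
      show "\<K> (map a ?M @ map z [0..<k]) \<in> {c - \<epsilon><..<c + \<epsilon>}"
        using near[of "K \<inter> F"] by auto
      show "set (map a ?R) \<subseteq> {c - \<epsilon><..<c + \<epsilon>}"
        using R K(2) by (auto simp: F_def abs_less_iff not_le)
    qed (use reg k in \<open>auto simp: regular_mean_def is_interval_oo\<close>)
    finally show ?thesis
      by auto
  qed
  then show ?thesis
    using \<open>\<delta> > 0\<close> by blast
qed

theorem theorem4p18:
  fixes \<K> :: "real list \<Rightarrow> real"
    and I :: "'i set"
    and a :: "'i \<Rightarrow> real"
    and c :: real
  assumes "regular_mean \<K>"
    and "infinite I"
    and "infinite (a ` I)"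
  shows "unordered_average_is \<K> I a c \<longleftrightarrow>
         ext_is (family_mean \<K> a) I (\<lambda>x y. \<bar>a x - a y\<bar>) c"
proof
  assume "unordered_average_is \<K> I a c"
  then have fin: "finite {i \<in> I. \<bar>a i - c\<bar> \<ge> \<epsilon>}" if "\<epsilon> > 0" for \<epsilon>
    using unordered_average_finite_outliers assms(1) that by blast
  show "ext_is (family_mean \<K> a) I (\<lambda>x y. \<bar>a x - a y\<bar>) c"
    unfolding ext_is_def
    using finite_outliers_imp_totally_bounded[OF fin assms(2)]
      family_mean_near_if_hausdorff_near[OF assms(1) fin assms(3)] by blast
next
  assume "ext_is (family_mean \<K> a) I (\<lambda>x y. \<bar>a x - a y\<bar>) c"
  then show "unordered_average_is \<K> I a c"
    by (rule ext_is_imp_unordered_average_is[rotated]) auto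
qed

end
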